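(* Let $g\ge 4$ and $k$ be integers with $k>\lceil g/2\rceil$. Then every transversal design {\rm TD}$(k+2,g)$ is group-equitably $2$-colourable.
   Context: A transversal design {\rm TD}$(n,g)$ consists of $ng$ points partitioned into $n$ groups of size $g$ and a collection of $n$-subsets (blocks) such that every pair of points from distinct groups lies in exactly one block and no pair from the same group lies in a block. A weak $c$-colouring is a map from the points to $c$ colours such that no block is monochromatic. A weak $c$-colouring of a GDD is group-equitable if each group of size $g$ contains either $\lfloor g/c\rfloor$ or $\lceil g/c\rceil$ points of each colour; a design is group-equitably $c$-colourable if it admits such a colouring. *)

theory Defs
  imports Complex_Main "HOL-Library.Disjoint_Sets"
begin

(* For n >= 2 a block cannot be repeated, since a pair inside it would lie in two blocks;
   so the collection of blocks is taken to be a set. *)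
definition transversal_design ::
  "nat \<Rightarrow> nat \<Rightarrow> 'a set \<Rightarrow> 'a set set \<Rightarrow> 'a set set \<Rightarrow> bool" where
  "transversal_design n g V \<G> \<B> \<longleftrightarrow>
     finite V \<and> card V = n * g \<and>
     partition_on V \<G> \<and> card \<G> = n \<and> (\<forall>X\<in>\<G>. card X = g) \<and>
     (\<forall>b\<in>\<B>. b \<subseteq> V \<and> card b = n) \<and>
     (\<forall>X\<in>\<G>. \<forall>Y\<in>\<G>. X \<noteq> Y \<longrightarrow>
        (\<forall>x\<in>X. \<forall>y\<in>Y. \<exists>!b. b \<in> \<B> \<and> x \<in> b \<and> y \<in> b)) \<and>
     (\<forall>X\<in>\<G>. \<forall>x\<in>X. \<forall>y\<in>X. x \<noteq> y \<longrightarrow>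
        \<not> (\<exists>b\<in>\<B>. x \<in> b \<and> y \<in> b))"

definition monochromatic :: "('a \<Rightarrow> nat) \<Rightarrow> 'a set \<Rightarrow> bool" where
  "monochromatic f b \<longleftrightarrow> (\<exists>i. \<forall>x\<in>b. f x = i)"

definition weak_colouring ::
  "nat \<Rightarrow> 'a set \<Rightarrow> 'a set set \<Rightarrow> ('a \<Rightarrow> nat) \<Rightarrow> bool" where
  "weak_colouring c V \<B> f \<longleftrightarrow>
     (\<forall>x\<in>V. f x < c) \<and> (\<forall>b\<in>\<B>. \<not> monochromatic f b)"

definition group_equitable :: "nat \<Rightarrow> 'a set set \<Rightarrow> ('a \<Rightarrow> nat) \<Rightarrow> bool" where
  "group_equitable c \<G> f \<longleftrightarrow>
     (\<forall>X\<in>\<G>. \<forall>i<c.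
        int (card {x \<in> X. f x = i}) = \<lfloor>real (card X) / real c\<rfloor> \<or>
        int (card {x \<in> X. f x = i}) = \<lceil>real (card X) / real c\<rceil>)"

definition group_equitably_colourable ::
  "nat \<Rightarrow> 'a set \<Rightarrow> 'a set set \<Rightarrow> 'a set set \<Rightarrow> bool" where
  "group_equitably_colourable c V \<G> \<B> \<longleftrightarrow>
     (\<exists>f. weak_colouring c V \<B> f \<and> group_equitable c \<G> f)"

end

theory Submission
  imports Defs
begin

text \<open>
  Fix a group-equitable colouring and consider all colourings obtained from it by exchanging the
  two colours on some of the groups; they are again group-equitable. If the exchanges are confined
  to the groups outside a nonempty family \<open>\<H>\<close>, a block that is monochromatic on \<open>\<H>\<close> becomes
  monochromatic in exactly one of the colourings, and no other block ever does. For a single group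
  \<open>\<H>\<close> this gives \<open>g\<^sup>2\<close> monochromatic blocks in total over \<open>2 ^ (n - 1)\<close> colourings. If
  \<open>g\<^sup>2 \<le> 2 ^ (n - 1)\<close>, start from a colouring with two monochromatic blocks: some other colouring
  then has none. The bound on \<open>k\<close> implies this inequality except when \<open>g = n = 6\<close>.

  In the exceptional case let \<open>\<H>\<close> consist of four groups; it suffices to colour these so that at
  most 3 blocks are monochromatic on \<open>\<H>\<close>. However the first three groups are halved, exactly 9
  blocks are monochromatic on them. Among any six integers there are three whose sum is divisible
  by 3, so the third group can be halved such that both colours occur a multiple of 3 times among
  these 9 blocks. A halving of the fourth group that leaves at most 3 of them then exists.
\<close>

section \<open>Averaging over exchanges of the two colours\<close>

text \<open>Double counting of pairs (flip set, row). Here \<open>\<phi> b X\<close> tells on which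
  side of group \<open>X\<close> the block \<open>b\<close> lies, and \<open>S\<close> is the set of
  exchanged groups. A row that is constant on \<open>H\<close> becomes constant on \<open>G\<close>
  under exactly one \<open>S\<close> disjoint from \<open>H\<close>; any other row does so under
  none.\<close>

lemma sum_card_flips:
  fixes \<phi> :: "'b \<Rightarrow> 'g \<Rightarrow> bool"
  assumes "finite B" "finite G" "H \<subseteq> G" "H \<noteq> {}"
  shows "(\<Sum>S\<in>Pow (G - H). card {b\<in>B. \<exists>c. \<forall>X\<in>G. (\<phi> b X \<noteq> (X \<in> S)) = c})
    = card {b\<in>B. \<exists>c. \<forall>X\<in>H. \<phi> b X = c}"
proof -
  have count: "card {S\<in>Pow (G - H). \<exists>c. \<forall>X\<in>G. (\<phi> b X \<noteq> (X \<in> S)) = c}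
    = (if \<exists>c. \<forall>X\<in>H. \<phi> b X = c then 1 else 0)" (is "card ?F = _") for b
  proof (cases "\<exists>c. \<forall>X\<in>H. \<phi> b X = c")
    case True
    then obtain c where c: "\<forall>X\<in>H. \<phi> b X = c" by blast
    from assms obtain X0 where X0: "X0 \<in> H" by blast
    \<comment> \<open>The flip set is forced: it must exchange exactly the groups on which
      \<open>b\<close> deviates from \<open>c\<close>. The group \<open>X0\<close> is never
      exchanged, which pins the final value to \<open>c\<close>.\<close>
    have "?F = {{X\<in>G. \<phi> b X \<noteq> c}}"
    proof (intro equalityI subsetI)
      fix S assume "S \<in> ?F"
      then obtain c' where S: "S \<subseteq> G - H" and c': "\<forall>X\<in>G. (\<phi> b X \<noteq> (X \<in> S)) = c'" by blast
      have "c' = c" using c c' X0 S assms(3) by blast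
      then show "S \<in> {{X\<in>G. \<phi> b X \<noteq> c}}" using S c' by blast
    next
      fix S assume "S \<in> {{X\<in>G. \<phi> b X \<noteq> c}}"
      then show "S \<in> ?F" using c assms(3) by auto
    qed
    then show ?thesis using True by simp
  next
    case False
    have "?F = {}"
    proof (rule ccontr)
      assume "?F \<noteq> {}"
      then obtain S c where "S \<subseteq> G - H" "\<forall>X\<in>G. (\<phi> b X \<noteq> (X \<in> S)) = c" by blast
      then have "\<forall>X\<in>H. \<phi> b X = c" using assms(3) by blast
      then show False using False by blast
    qed
    then show ?thesis using False by (simp only: card.empty if_False)
  qed
  have fin: "finite (Pow (G - H))" using assms by simp
  have "(\<Sum>S\<in>Pow (G - H). card {b\<in>B. \<exists>c. \<forall>X\<in>G. (\<phi> b X \<noteq> (X \<in> S)) = c})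
    = (\<Sum>b\<in>B. card {S\<in>Pow (G - H). \<exists>c. \<forall>X\<in>G. (\<phi> b X \<noteq> (X \<in> S)) = c})"
    by (rule sum_multicount_gen[OF fin assms(1)]) simp
  also have "\<dots> = card {b\<in>B. \<exists>c. \<forall>X\<in>H. \<phi> b X = c}"
    unfolding count using assms(1) by (simp add: sum.If_cases Int_def)
  finally show ?thesis .
qed

text \<open>If every flip left a constant row, each of the \<open>2 ^ card (G - H)\<close> flips
  would contribute at least 1 to the total of \<open>sum_card_flips\<close>. The total is either too
  small for that, or just large enough while the empty flip contributes 2.\<close>

lemma exists_flip_without_constant:
  fixes \<phi> :: "'b \<Rightarrow> 'g \<Rightarrow> bool"
  assumes fin: "finite B" "finite G" and H: "H \<subseteq> G" "H \<noteq> {}"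
    and le: "card {b\<in>B. \<exists>c. \<forall>X\<in>H. \<phi> b X = c} \<le> 2 ^ card (G - H)"
    and ex: "card {b\<in>B. \<exists>c. \<forall>X\<in>H. \<phi> b X = c} < 2 ^ card (G - H) \<or>
      2 \<le> card {b\<in>B. \<exists>c. \<forall>X\<in>G. \<phi> b X = c}"
  shows "\<exists>S\<subseteq>G. \<forall>b\<in>B. \<not> (\<exists>c. \<forall>X\<in>G. (\<phi> b X \<noteq> (X \<in> S)) = c)"
proof (rule ccontr)
  assume no: "\<not> ?thesis"
  define K where "K S b \<longleftrightarrow> (\<exists>c. \<forall>X\<in>G. (\<phi> b X \<noteq> (X \<in> S)) = c)" for S b
  define m where "m S = card {b\<in>B. K S b}" for S
  have m1: "1 \<le> m S" if "S \<in> Pow (G - H)" for S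
  proof -
    have "{b\<in>B. K S b} \<noteq> {}" using no that unfolding K_def[symmetric] by blast
    then show ?thesis unfolding m_def using fin(1) by (simp add: Suc_le_eq card_gt_0_iff)
  qed
  have tot: "(\<Sum>S\<in>Pow (G - H). m S) = card {b\<in>B. \<exists>c. \<forall>X\<in>H. \<phi> b X = c}"
    unfolding m_def K_def by (rule sum_card_flips[OF fin H])
  have finP: "finite (Pow (G - H))" using fin by simp
  have c1: "(\<Sum>S\<in>Pow (G - H). 1::nat) = 2 ^ card (G - H)"
    using fin by (simp add: card_Pow)
  have ge: "(\<Sum>S\<in>Pow (G - H). 1) \<le> (\<Sum>S\<in>Pow (G - H). m S)"
    by (rule sum_mono) (rule m1)
  have "m {} = card {b\<in>B. \<exists>c. \<forall>X\<in>G. \<phi> b X = c}" unfolding m_def K_def by simp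
  \<comment> \<open>The first alternative of \<open>ex\<close> contradicts \<open>ge\<close>
    outright, so only the second is left.\<close>
  with ex ge tot c1 have "1 < m {}" by linarith
  then have "(\<Sum>S\<in>Pow (G - H). 1) < (\<Sum>S\<in>Pow (G - H). m S)"
    by (intro sum_strict_mono_ex1[OF finP]) (use m1 in auto)
  then show False using le tot c1 by linarith
qed

section \<open>Halving a six-element set\<close>

text \<open>Pigeonhole on residues mod 3: either three elements share a residue, or each class has
  at most two elements, and then all three classes are inhabited and 0 + 1 + 2 is divisible by
  3.\<close>

lemma exists_triple_sum_dvd_3:
  fixes a :: "'a \<Rightarrow> nat"
  assumes "card X = 6"
  shows "\<exists>T\<subseteq>X. card T = 3 \<and> 3 dvd sum a T"
proof -
  define L where "L r = {x\<in>X. a x mod 3 = r}" for r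
  show ?thesis
  proof (cases "\<exists>r. 3 \<le> card (L r)")
    case True
    then obtain r T where T: "T \<subseteq> L r" "card T = 3"
      by (meson obtain_subset_with_card_n)
    have "sum a T mod 3 = (\<Sum>x\<in>T. a x mod 3) mod 3" by (simp add: mod_sum_eq)
    also have "(\<Sum>x\<in>T. a x mod 3) = (\<Sum>x\<in>T. r)"
      by (rule sum.cong) (use T in \<open>auto simp: L_def\<close>)
    finally have "3 dvd sum a T" using T by (simp add: mod_eq_0_iff_dvd)
    then show ?thesis using T by (auto simp: L_def)
  next
    case False
    have "X = (\<Union>r\<in>{0,1,2}. L r)" by (auto simp: L_def)
    then have "card X \<le> (\<Sum>r\<in>{0,1,2}. card (L r))" by (metis card_UN_le finite.emptyI finite.insertI)
    then have "6 \<le> card (L 0) + card (L 1) + card (L 2)" using assms by simp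
    moreover have "card (L r) \<le> 2" for r using False by (metis not_less_eq_eq numeral_2_eq_2 numeral_3_eq_3)
    note this[of 0] this[of 1] this[of 2]
    ultimately have "card (L 0) \<noteq> 0" "card (L 1) \<noteq> 0" "card (L 2) \<noteq> 0" by linarith+
    then have "L 0 \<noteq> {}" "L 1 \<noteq> {}" "L 2 \<noteq> {}" by (metis card.empty)+
    then obtain x y z where x: "x \<in> L 0" and y: "y \<in> L 1" and z: "z \<in> L 2" by blast
    have "a x mod 3 = 0" "a y mod 3 = 1" "a z mod 3 = 2" using x y z by (auto simp: L_def)
    moreover from this have "x \<noteq> y" "x \<noteq> z" "y \<noteq> z" by auto
    moreover have "{x,y,z} \<subseteq> X" using x y z by (auto simp: L_def)
    moreover have "3 dvd a x + (a y + a z)" using calculation(1-3) by presburger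
    ultimately show ?thesis by (intro exI[of _ "{x,y,z}"]) simp
  qed
qed

text \<open>Used to halve the fourth group: \<open>u x\<close> and \<open>v x\<close> count the
  blocks through \<open>x\<close> that are so far monochromatic in the first and second colour, and
  giving \<open>T\<close> the first colour leaves \<open>sum u T + sum v (X - T)\<close> of
  them.\<close>

lemma exists_triple_weight_le_3:
  fixes u v :: "'a \<Rightarrow> nat"
  assumes "card X = 6" "sum u X + sum v X = 9" "3 dvd sum u X"
  shows "\<exists>T\<subseteq>X. card T = 3 \<and> sum u T + sum v (X - T) \<le> 3"
proof -
  have fin: "finite X" using assms card.infinite by fastforce
  obtain y where y: "sum u X = 3 * y" using assms(3) by blast
  \<comment> \<open>\<open>d x\<close> is the change in weight when \<open>x\<close> joins
    \<open>T\<close>; the empty \<open>T\<close> has weight \<open>sum v X\<close>, which is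
    \<open>9 - 3 * y\<close>.\<close>
  define d where "d x = int (u x) - int (v x)" for x
  have w: "int (sum u T + sum v (X - T)) = 9 - 3 * int y + sum d T" if "T \<subseteq> X" for T
  proof -
    have "sum v X = sum v T + sum v (X - T)"
      using sum.subset_diff[OF that fin, of v] by simp
    then show ?thesis using assms(2) y by (simp add: d_def sum_subtractf flip: of_nat_sum)
  qed
  have tot: "sum d X = 6 * int y - 9"
    using assms(2) y by (simp add: d_def sum_subtractf flip: of_nat_sum)
  \<comment> \<open>The average of \<open>d\<close> over \<open>X\<close> is \<open>y - 3/2\<close>. Three values at most \<open>y - 2\<close> give a triple
    of weight at most 3; three values at least \<open>y - 1\<close> give one of weight at least 6, whose
    complement has weight at most 3.\<close>
  define L where "L = {x\<in>X. d x \<le> int y - 2}"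
  show ?thesis
  proof (cases "3 \<le> card L")
    case True
    then obtain T where T: "T \<subseteq> L" "card T = 3" by (meson obtain_subset_with_card_n)
    have "sum d T \<le> of_nat (card T) * (int y - 2)"
      by (rule sum_bounded_above) (use T in \<open>auto simp: L_def\<close>)
    then have "sum d T \<le> 3 * int y - 6" using T by simp
    moreover have "T \<subseteq> X" using T by (auto simp: L_def)
    ultimately show ?thesis using w[of T] T by (intro exI[of _ T]) linarith
  next
    case False
    have "card (X - L) = 6 - card L"
      using assms(1) fin by (subst card_Diff_subset) (auto simp: L_def)
    then have "3 \<le> card (X - L)" using False by simp
    then obtain T where T: "T \<subseteq> X - L" "card T = 3" by (meson obtain_subset_with_card_n)
    have "of_nat (card T) * (int y - 1) \<le> sum d T"
      by (rule sum_bounded_below) (use T in \<open>auto simp: L_def\<close>)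
    then have "3 * int y - 3 \<le> sum d T" using T by simp
    moreover have "T \<subseteq> X" using T by auto
    then have "sum d X = sum d (X - T) + sum d T" by (rule sum.subset_diff[OF _ fin])
    ultimately have "int (sum u (X - T) + sum v (X - (X - T))) \<le> 3"
      using w[of "X - T"] tot by auto
    moreover have "card (X - T) = 3"
      using \<open>T \<subseteq> X\<close> T assms(1) fin by (simp add: card_Diff_subset finite_subset)
    ultimately show ?thesis by (intro exI[of _ "X - T"]) (auto simp flip: of_nat_sum of_nat_add)
  qed
qed

section \<open>Blocks as transversals of the groups\<close>

locale TD =
  fixes n g :: nat and V :: "'a set" and \<G> \<B> :: "'a set set"
  assumes td: "transversal_design n g V \<G> \<B>" and g_pos: "0 < g"
begin

lemma finite_points: "finite V" and part: "partition_on V \<G>" and card_groups: "card \<G> = n"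
  using td by (simp_all only: transversal_design_def)

lemma card_group: "X \<in> \<G> \<Longrightarrow> card X = g"
  using td by (simp only: transversal_design_def)

lemma block_subset: "b \<in> \<B> \<Longrightarrow> b \<subseteq> V" and card_block: "b \<in> \<B> \<Longrightarrow> card b = n"
  using td by (simp_all only: transversal_design_def)

lemma ex1_block:
  assumes "X \<in> \<G>" "Y \<in> \<G>" "X \<noteq> Y" "x \<in> X" "y \<in> Y"
  shows "\<exists>!b. b \<in> \<B> \<and> x \<in> b \<and> y \<in> b"
proof -
  have "\<forall>X\<in>\<G>. \<forall>Y\<in>\<G>. X \<noteq> Y \<longrightarrow> (\<forall>x\<in>X. \<forall>y\<in>Y. \<exists>!b. b \<in> \<B> \<and> x \<in> b \<and> y \<in> b)"
    using td unfolding transversal_design_def by (elim conjE)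
  from this[rule_format, OF assms] show ?thesis .
qed

lemma block_group_eq:
  assumes "X \<in> \<G>" "b \<in> \<B>" "x \<in> X" "y \<in> X" "x \<in> b" "y \<in> b"
  shows "x = y"
proof -
  have "\<forall>X\<in>\<G>. \<forall>x\<in>X. \<forall>y\<in>X. x \<noteq> y \<longrightarrow> \<not> (\<exists>b\<in>\<B>. x \<in> b \<and> y \<in> b)"
    using td unfolding transversal_design_def by (elim conjE)
  then show ?thesis using assms by blast
qed

lemma finite_groups: "finite \<G>"
  using part finite_points by (rule finite_elements[rotated])

lemma finite_group: "X \<in> \<G> \<Longrightarrow> finite X"
  using card_group g_pos card_ge_0_finite by metis

lemma finite_blocks: "finite \<B>"
  by (rule finite_subset[of _ "Pow V"]) (use block_subset finite_points in auto)

lemma group_unique: "\<lbrakk>X \<in> \<G>; Y \<in> \<G>; x \<in> X; x \<in> Y\<rbrakk> \<Longrightarrow> X = Y"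
  using partition_onD2[OF part] by (auto simp: disjoint_def)

text \<open>Distinct points of a block lie in distinct groups, and there are as many groups as
  points in the block, so the injection from points to groups is onto.\<close>

lemma ex1_meet:
  assumes b: "b \<in> \<B>" and X: "X \<in> \<G>"
  shows "\<exists>!x. x \<in> b \<and> x \<in> X"
proof -
  define gr where "gr x = (THE Y. Y \<in> \<G> \<and> x \<in> Y)" for x
  have gr: "gr x \<in> \<G> \<and> x \<in> gr x" if "x \<in> b" for x
  proof -
    have "\<exists>!Y. Y \<in> \<G> \<and> x \<in> Y"
      using that block_subset[OF b] partition_onD1[OF part] group_unique by blast
    then show ?thesis unfolding gr_def by (rule theI')
  qed
  have "inj_on gr b"
    using gr block_group_eq[OF _ b] by (intro inj_onI) metis
  then have "card (gr ` b) = card \<G>" using card_image card_block[OF b] card_groups by metis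
  then have "gr ` b = \<G>" using gr by (intro card_subset_eq finite_groups) auto
  then obtain x where "x \<in> b" "X = gr x" using X by blast
  then show ?thesis using gr block_group_eq[OF X b] by blast
qed

definition meet :: "'a set \<Rightarrow> 'a set \<Rightarrow> 'a" where
  "meet b X = (THE x. x \<in> b \<and> x \<in> X)"

lemma meet: "\<lbrakk>b \<in> \<B>; X \<in> \<G>\<rbrakk> \<Longrightarrow> meet b X \<in> b" "\<lbrakk>b \<in> \<B>; X \<in> \<G>\<rbrakk> \<Longrightarrow> meet b X \<in> X"
  using theI'[OF ex1_meet] unfolding meet_def by blast+

lemma meet_eq: "\<lbrakk>b \<in> \<B>; X \<in> \<G>; x \<in> b; x \<in> X\<rbrakk> \<Longrightarrow> meet b X = x"
  using meet block_group_eq by metis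

text \<open>A block is determined by its points in two distinct groups, and every pair of such
  points occurs.\<close>

lemma card_blocks_meet2:
  assumes XY: "X \<in> \<G>" "Y \<in> \<G>" "X \<noteq> Y" and PQ: "P \<subseteq> X" "Q \<subseteq> Y"
  shows "card {b\<in>\<B>. meet b X \<in> P \<and> meet b Y \<in> Q} = card P * card Q"
proof -
  have "bij_betw (\<lambda>b. (meet b X, meet b Y)) {b\<in>\<B>. meet b X \<in> P \<and> meet b Y \<in> Q} (P \<times> Q)"
  proof (rule bij_betwI')
    fix b b' assume b: "b \<in> {b\<in>\<B>. meet b X \<in> P \<and> meet b Y \<in> Q}"
      and b': "b' \<in> {b\<in>\<B>. meet b X \<in> P \<and> meet b Y \<in> Q}"
    show "((meet b X, meet b Y) = (meet b' X, meet b' Y)) = (b = b')"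
      using ex1_block[OF XY meet(2)[of b X] meet(2)[of b Y]] meet(1)[of b] meet(1)[of b'] b b' XY
      by (metis (mono_tags, lifting) mem_Collect_eq prod.inject)
  next
    fix b assume "b \<in> {b\<in>\<B>. meet b X \<in> P \<and> meet b Y \<in> Q}"
    then show "(meet b X, meet b Y) \<in> P \<times> Q" by simp
  next
    fix p assume p: "p \<in> P \<times> Q"
    then obtain x y where xy: "p = (x, y)" "x \<in> P" "y \<in> Q" by blast
    then obtain b where b: "b \<in> \<B>" "x \<in> b" "y \<in> b" using ex1_block[OF XY, of x y] PQ by blast
    then have "meet b X = x" "meet b Y = y" using XY PQ xy by (auto intro!: meet_eq)
    then show "\<exists>b\<in>{b\<in>\<B>. meet b X \<in> P \<and> meet b Y \<in> Q}. p = (meet b X, meet b Y)"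
      using b xy by auto
  qed
  then show ?thesis by (simp add: bij_betw_same_card card_cartesian_product)
qed

lemma card_blocks:
  assumes "2 \<le> n"
  shows "card \<B> = g\<^sup>2"
proof -
  obtain X Y where XY: "X \<in> \<G>" "Y \<in> \<G>" "X \<noteq> Y"
    using assms card_groups finite_groups by (metis card_le_Suc0_iff_eq not_less_eq_eq numeral_2_eq_2)
  have "{b\<in>\<B>. meet b X \<in> X \<and> meet b Y \<in> Y} = \<B>" using meet XY by auto
  then show ?thesis
    using card_blocks_meet2[OF XY order_refl order_refl] card_group XY by (simp add: power2_eq_square)
qed

lemma sum_card_meet:
  assumes "finite T"
  shows "(\<Sum>i\<in>T. card {b\<in>\<B>. Q b \<and> meet b X = i}) = card {b\<in>\<B>. Q b \<and> meet b X \<in> T}"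
proof -
  have "{b\<in>\<B>. Q b \<and> meet b X \<in> T} = (\<Union>i\<in>T. {b\<in>\<B>. Q b \<and> meet b X = i})" by auto
  then show ?thesis using assms finite_blocks by (simp only:) (subst card_UN_disjoint; auto)
qed

lemma card_blocks_split:
  "card {b\<in>\<B>. Q b} = card {b\<in>\<B>. Q b \<and> R b} + card {b\<in>\<B>. Q b \<and> \<not> R b}"
proof -
  have "{b\<in>\<B>. Q b} = {b\<in>\<B>. Q b \<and> R b} \<union> {b\<in>\<B>. Q b \<and> \<not> R b}" by auto
  then show ?thesis using finite_blocks by (simp only:) (subst card_Un_disjoint; auto)
qed

section \<open>From halved groups to colourings\<close>

text \<open>\<open>A\<close> is the class of colour 1. The two admissible sizes are the floor and
  the ceiling of \<open>g / 2\<close>; they add up to \<open>g\<close>, so the complement within a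
  group is admissible too.\<close>

lemma colourable_if:
  assumes eq: "\<And>X. X \<in> \<G> \<Longrightarrow> card (X \<inter> A) = g div 2 \<or> card (X \<inter> A) = g - g div 2"
    and mono: "\<And>b. b \<in> \<B> \<Longrightarrow> \<not> (\<exists>c. \<forall>X\<in>\<G>. (meet b X \<in> A) = c)"
  shows "group_equitably_colourable 2 V \<G> \<B>"
proof -
  define f where "f x = (if x \<in> A then 1 else 0 :: nat)" for x
  have "\<not> monochromatic f b" if b: "b \<in> \<B>" for b
  proof
    assume "monochromatic f b"
    then obtain i where "\<forall>x\<in>b. f x = i" by (auto simp: monochromatic_def)
    then have "\<forall>X\<in>\<G>. (meet b X \<in> A) = (i = 1)" using meet(1)[OF b] unfolding f_def by (metis zero_neq_one)
    then show False using mono[OF b] by blast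
  qed
  then have "weak_colouring 2 V \<B> f" by (auto simp: weak_colouring_def f_def)
  moreover have "group_equitable 2 \<G> f"
    unfolding group_equitable_def
  proof (intro ballI allI impI)
    fix X i assume X: "X \<in> \<G>" and i: "i < (2::nat)"
    have "i = 0 \<or> i = 1" using i by auto
    then have "{x\<in>X. f x = i} = X \<inter> A \<or> {x\<in>X. f x = i} = X - X \<inter> A"
      by (auto simp: f_def)
    moreover have "card (X - X \<inter> A) = g - card (X \<inter> A)"
      using finite_group[OF X] card_group[OF X] by (simp add: card_Diff_subset)
    ultimately have c: "card {x\<in>X. f x = i} = g div 2 \<or> card {x\<in>X. f x = i} = g - g div 2"
      using eq[OF X] by auto
    have "\<lfloor>real g / real 2\<rfloor> = int (g div 2)" using floor_divide_of_nat_eq[of g 2] by simp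
    moreover have "\<lceil>real g / real 2\<rceil> = int (g - g div 2)"
      by linarith
    ultimately show "int (card {x\<in>X. f x = i}) = \<lfloor>real (card X) / real 2\<rfloor> \<or>
        int (card {x\<in>X. f x = i}) = \<lceil>real (card X) / real 2\<rceil>"
      using c card_group[OF X] by metis
  qed
  ultimately show ?thesis unfolding group_equitably_colourable_def by blast
qed

text \<open>Exchanging the colours on \<open>X\<close> replaces the half \<open>P X\<close> by
  \<open>X - P X\<close>, which keeps the colouring equitable;
  \<open>exists_flip_without_constant\<close> supplies the exchanges.\<close>

lemma colourable_by_flipping:
  assumes P: "\<And>X. X \<in> \<G> \<Longrightarrow> P X \<subseteq> X \<and> (card (P X) = g div 2 \<or> card (P X) = g - g div 2)"
    and H: "\<H> \<subseteq> \<G>" "\<H> \<noteq> {}"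
    and le: "card {b\<in>\<B>. \<exists>c. \<forall>X\<in>\<H>. (meet b X \<in> P X) = c} \<le> 2 ^ card (\<G> - \<H>)"
    and ex: "card {b\<in>\<B>. \<exists>c. \<forall>X\<in>\<H>. (meet b X \<in> P X) = c} < 2 ^ card (\<G> - \<H>) \<or>
      2 \<le> card {b\<in>\<B>. \<exists>c. \<forall>X\<in>\<G>. (meet b X \<in> P X) = c}"
  shows "group_equitably_colourable 2 V \<G> \<B>"
proof -
  obtain S where S: "S \<subseteq> \<G>"
    "\<forall>b\<in>\<B>. \<not> (\<exists>c. \<forall>X\<in>\<G>. ((meet b X \<in> P X) \<noteq> (X \<in> S)) = c)"
    using exists_flip_without_constant[OF finite_blocks finite_groups H le ex] by blast
  define A where "A = (\<Union>X\<in>\<G>. if X \<in> S then X - P X else P X)"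
  have A: "X \<inter> A = (if X \<in> S then X - P X else P X)" if "X \<in> \<G>" for X
    using that P group_unique by (fastforce simp: A_def split: if_splits)
  show ?thesis
  proof (rule colourable_if)
    fix X assume X: "X \<in> \<G>"
    have "card (X - P X) = g - card (P X)"
      using finite_group[OF X] card_group[OF X] P[OF X] by (metis card_Diff_subset finite_subset)
    then show "card (X \<inter> A) = g div 2 \<or> card (X \<inter> A) = g - g div 2"
      using A[OF X] P[OF X] by auto
  next
    fix b assume b: "b \<in> \<B>"
    have "(meet b X \<in> A) = ((meet b X \<in> P X) \<noteq> (X \<in> S))" if "X \<in> \<G>" for X
      using A[OF that] meet(2)[OF b that] by (auto split: if_splits)
    then show "\<not> (\<exists>c. \<forall>X\<in>\<G>. (meet b X \<in> A) = c)" using S(2) b by auto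
  qed
qed

section \<open>The general case and the exceptional case\<close>

lemma colourable_if_square_le:
  assumes "4 \<le> g" "2 \<le> n" "g\<^sup>2 \<le> 2 ^ (n - 1)"
  shows "group_equitably_colourable 2 V \<G> \<B>"
proof -
  have cB: "card \<B> = g\<^sup>2" by (rule card_blocks[OF assms(2)])
  have "1 < g\<^sup>2" using assms(1) by (intro one_less_power) auto
  then obtain b1 b2 where b: "b1 \<in> \<B>" "b2 \<in> \<B>" "b1 \<noteq> b2"
    using cB finite_blocks by (metis One_nat_def card_le_Suc0_iff_eq not_le)
  \<comment> \<open>Halves containing the points of both \<open>b1\<close> and \<open>b2\<close>
    make these two blocks monochromatic at the start; there is room since \<open>g div 2\<close> is
    at least 2. This covers equality of \<open>g\<^sup>2\<close> and \<open>2 ^ (n - 1)\<close>, as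
    for \<open>g = 4\<close>, \<open>n = 5\<close>.\<close>
  have "\<exists>P. {meet b1 X, meet b2 X} \<subseteq> P \<and> P \<subseteq> X \<and> card P = g div 2" if X: "X \<in> \<G>" for X
  proof (rule exists_subset_between)
    show "card {meet b1 X, meet b2 X} \<le> g div 2"
      using card_insert_le_m1[of 2 "{meet b2 X}" "meet b1 X"] assms(1) by simp
    show "g div 2 \<le> card X" using card_group[OF X] by simp
  qed (use X meet b finite_group in auto)
  then obtain P where P: "\<And>X. X \<in> \<G> \<Longrightarrow>
      {meet b1 X, meet b2 X} \<subseteq> P X \<and> P X \<subseteq> X \<and> card (P X) = g div 2"
    by metis
  obtain X0 where X0: "X0 \<in> \<G>" using assms(2) card_groups by fastforce
  \<comment> \<open>Every block is trivially constant on a single group.\<close>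
  have c0: "card {b\<in>\<B>. \<exists>c. \<forall>X\<in>{X0}. (meet b X \<in> P X) = c} = g\<^sup>2" using cB by simp
  have c1: "card (\<G> - {X0}) = n - 1" using X0 card_groups by simp
  have "{b1, b2} \<subseteq> {b\<in>\<B>. \<exists>c. \<forall>X\<in>\<G>. (meet b X \<in> P X) = c}" using b P by auto
  then have "card {b1, b2} \<le> card {b\<in>\<B>. \<exists>c. \<forall>X\<in>\<G>. (meet b X \<in> P X) = c}"
    by (rule card_mono[rotated]) (simp add: finite_blocks)
  then have "2 \<le> card {b\<in>\<B>. \<exists>c. \<forall>X\<in>\<G>. (meet b X \<in> P X) = c}" using b by simp
  then show ?thesis
    using colourable_by_flipping[of P "{X0}"] P X0 assms(3) c0 c1 by auto
qed

text \<open>The 36 blocks exceed \<open>2 ^ 5\<close>, so one fixed group is not enough. Four fixed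
  groups leave two free ones and hence 4 colourings, which suffices once at most 3 blocks are
  monochromatic on the fixed groups.\<close>

lemma colourable_6_6:
  assumes g: "g = 6" and n: "n = 6"
  shows "group_equitably_colourable 2 V \<G> \<B>"
proof -
  obtain \<H> where \<H>: "\<H> \<subseteq> \<G>" "card \<H> = 4"
    using obtain_subset_with_card_n[of 4 \<G>] card_groups n by auto
  then obtain X1 X2 X3 X4 where H: "\<H> = {X1, X2, X3, X4}"
    and dist: "X1 \<noteq> X2" "X1 \<noteq> X3" "X1 \<noteq> X4" "X2 \<noteq> X3" "X2 \<noteq> X4" "X3 \<noteq> X4"
    by (auto simp: card_Suc_eq eval_nat_numeral)
  have G: "X1 \<in> \<G>" "X2 \<in> \<G>" "X3 \<in> \<G>" "X4 \<in> \<G>" using \<H> H by auto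
  have "\<exists>P\<subseteq>X. card P = 3" if "X \<in> \<G>" for X
    using obtain_subset_with_card_n[of 3 X] card_group[OF that] g by auto
  then obtain P0 where P0: "\<And>X. X \<in> \<G> \<Longrightarrow> P0 X \<subseteq> X \<and> card (P0 X) = 3" by metis
  define in12 where "in12 b \<longleftrightarrow> meet b X1 \<in> P0 X1 \<and> meet b X2 \<in> P0 X2" for b
  define out12 where "out12 b \<longleftrightarrow> meet b X1 \<notin> P0 X1 \<and> meet b X2 \<notin> P0 X2" for b
  define a where "a i = card {b\<in>\<B>. in12 b \<and> meet b X3 = i}" for i
  \<comment> \<open>Inclusion-exclusion: of the 6 blocks through \<open>i\<close>, 3 meet
    \<open>P0 X1\<close> and 3 meet \<open>P0 X2\<close>, so those meeting neither number 6 - 3 - 3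
    + \<open>a i\<close>.\<close>
  have out_a: "card {b\<in>\<B>. out12 b \<and> meet b X3 = i} = a i" if i: "i \<in> X3" for i
  proof -
    have "card {b\<in>\<B>. meet b X3 \<in> {i} \<and> meet b X1 \<in> X1} = 6"
      by (subst card_blocks_meet2) (use G dist i card_group g in auto)
    moreover have "{b\<in>\<B>. meet b X3 \<in> {i} \<and> meet b X1 \<in> X1} = {b\<in>\<B>. meet b X3 = i}"
      using meet G by auto
    ultimately have c: "card {b\<in>\<B>. meet b X3 = i} = 6" by simp
    have "card {b\<in>\<B>. meet b X3 \<in> {i} \<and> meet b X1 \<in> P0 X1} = 3"
      by (subst card_blocks_meet2) (use G dist i P0 in auto)
    then have c1: "card {b\<in>\<B>. meet b X3 = i \<and> meet b X1 \<in> P0 X1} = 3" by simp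
    have "card {b\<in>\<B>. meet b X3 \<in> {i} \<and> meet b X2 \<in> P0 X2} = 3"
      by (subst card_blocks_meet2) (use G dist i P0 in auto)
    then have c2: "card {b\<in>\<B>. meet b X3 = i \<and> meet b X2 \<in> P0 X2} = 3" by simp
    have "card {b\<in>\<B>. (meet b X3 = i \<and> meet b X2 \<in> P0 X2) \<and> meet b X1 \<in> P0 X1} = a i"
      unfolding a_def in12_def by (rule arg_cong[of _ _ card]) auto
    moreover have "card {b\<in>\<B>. (meet b X3 = i \<and> meet b X1 \<notin> P0 X1) \<and> meet b X2 \<notin> P0 X2}
        = card {b\<in>\<B>. out12 b \<and> meet b X3 = i}"
      unfolding out12_def by (rule arg_cong[of _ _ card]) auto
    moreover have "card {b\<in>\<B>. (meet b X3 = i \<and> meet b X1 \<notin> P0 X1) \<and> meet b X2 \<in> P0 X2}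
        = card {b\<in>\<B>. (meet b X3 = i \<and> meet b X2 \<in> P0 X2) \<and> meet b X1 \<notin> P0 X1}"
      by (rule arg_cong[of _ _ card]) auto
    ultimately show ?thesis
      using c c1 c2
        card_blocks_split[of "\<lambda>b. meet b X3 = i" "\<lambda>b. meet b X1 \<in> P0 X1"]
        card_blocks_split[of "\<lambda>b. meet b X3 = i \<and> meet b X1 \<notin> P0 X1" "\<lambda>b. meet b X2 \<in> P0 X2"]
        card_blocks_split[of "\<lambda>b. meet b X3 = i \<and> meet b X2 \<in> P0 X2" "\<lambda>b. meet b X1 \<in> P0 X1"]
      by linarith
  qed
  obtain T3 where T3: "T3 \<subseteq> X3" "card T3 = 3" "3 dvd sum a T3"
    using exists_triple_sum_dvd_3[of X3 a] card_group G g by blast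
  define in123 where "in123 b \<longleftrightarrow> in12 b \<and> meet b X3 \<in> T3" for b
  define out123 where "out123 b \<longleftrightarrow> out12 b \<and> meet b X3 \<notin> T3" for b
  have fin3: "finite X3" "finite T3" and fin4: "finite X4"
    using finite_group G T3 finite_subset by blast+
  have N1: "card {b\<in>\<B>. in123 b} = sum a T3"
    unfolding in123_def a_def by (rule sum_card_meet[symmetric]) (rule fin3)
  have "card {b\<in>\<B>. out123 b} = card {b\<in>\<B>. out12 b \<and> meet b X3 \<in> X3 - T3}"
    unfolding out123_def by (rule arg_cong[of _ _ card]) (use meet G in auto)
  also have "\<dots> = (\<Sum>i\<in>X3 - T3. card {b\<in>\<B>. out12 b \<and> meet b X3 = i})"
    by (rule sum_card_meet[symmetric]) (use fin3 in auto)
  also have "\<dots> = sum a (X3 - T3)" by (rule sum.cong) (use out_a in auto)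
  finally have N0: "card {b\<in>\<B>. out123 b} = sum a (X3 - T3)" .
  have "sum a X3 = card {b\<in>\<B>. in12 b \<and> meet b X3 \<in> X3}"
    unfolding a_def by (rule sum_card_meet) (rule fin3)
  also have "\<dots> = card {b\<in>\<B>. meet b X1 \<in> P0 X1 \<and> meet b X2 \<in> P0 X2}"
    unfolding in12_def by (rule arg_cong[of _ _ card]) (use meet G in auto)
  also have "\<dots> = 9" by (subst card_blocks_meet2) (use G dist P0 in auto)
  \<comment> \<open>Both colours are counted by the same function \<open>a\<close>, so the total is
    \<open>sum a X3\<close> whatever \<open>T3\<close> is.\<close>
  finally have N: "card {b\<in>\<B>. in123 b} + card {b\<in>\<B>. out123 b} = 9"
    unfolding N1 N0 using sum.subset_diff[OF T3(1) fin3(1), of a] by simp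
  define u where "u i = card {b\<in>\<B>. in123 b \<and> meet b X4 = i}" for i
  define v where "v i = card {b\<in>\<B>. out123 b \<and> meet b X4 = i}" for i
  have u: "sum u T = card {b\<in>\<B>. in123 b \<and> meet b X4 \<in> T}" if "T \<subseteq> X4" for T
    unfolding u_def by (rule sum_card_meet) (use that fin4 finite_subset in auto)
  have v: "sum v T = card {b\<in>\<B>. out123 b \<and> meet b X4 \<in> T}" if "T \<subseteq> X4" for T
    unfolding v_def by (rule sum_card_meet) (use that fin4 finite_subset in auto)
  have "{b\<in>\<B>. in123 b \<and> meet b X4 \<in> X4} = {b\<in>\<B>. in123 b}"
    "{b\<in>\<B>. out123 b \<and> meet b X4 \<in> X4} = {b\<in>\<B>. out123 b}" using meet G by auto
  then have "sum u X4 = card {b\<in>\<B>. in123 b}" "sum v X4 = card {b\<in>\<B>. out123 b}"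
    using u[of X4] v[of X4] by auto
  then obtain T4 where T4: "T4 \<subseteq> X4" "card T4 = 3" "sum u T4 + sum v (X4 - T4) \<le> 3"
    using exists_triple_weight_le_3[of X4 u v] card_group G g N N1 T3(3) by auto
  define P where "P = P0(X3 := T3, X4 := T4)"
  \<comment> \<open>The constant \<open>c\<close> true gives the first set of the union,
    \<open>c\<close> false the second.\<close>
  have "{b\<in>\<B>. \<exists>c. \<forall>X\<in>\<H>. (meet b X \<in> P X) = c}
    \<subseteq> {b\<in>\<B>. in123 b \<and> meet b X4 \<in> T4} \<union> {b\<in>\<B>. out123 b \<and> meet b X4 \<in> X4 - T4}"
    using meet(2) G dist by (auto simp: H P_def in123_def in12_def out123_def out12_def)
  then have "card {b\<in>\<B>. \<exists>c. \<forall>X\<in>\<H>. (meet b X \<in> P X) = c}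
    \<le> card ({b\<in>\<B>. in123 b \<and> meet b X4 \<in> T4} \<union> {b\<in>\<B>. out123 b \<and> meet b X4 \<in> X4 - T4})"
    by (rule card_mono[rotated]) (simp add: finite_blocks)
  also have "\<dots> \<le> sum u T4 + sum v (X4 - T4)"
    using u[OF T4(1)] v[of "X4 - T4"] by (simp add: card_Un_le)
  finally have "card {b\<in>\<B>. \<exists>c. \<forall>X\<in>\<H>. (meet b X \<in> P X) = c} < 4" using T4(3) by linarith
  moreover have "card (\<G> - \<H>) = 2"
    using \<H> card_groups n by (simp add: card_Diff_subset finite_subset[OF _ finite_groups])
  ultimately show ?thesis
    using \<H> H T3 T4 P0 g by (intro colourable_by_flipping[of P \<H>]) (auto simp: P_def)
qed

end

text \<open>Equality holds at 4; in the induction step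
  \<open>2 * m + 1 \<le> 4 * m \<le> m * m\<close>, so the square at most doubles.\<close>

lemma square_le_two_power:
  fixes m :: nat
  assumes "4 \<le> m"
  shows "m\<^sup>2 \<le> 2 ^ m"
  using assms
proof (induction m rule: nat_induct_at_least)
  case base
  show ?case by simp
next
  case (Suc m)
  have "4 * m \<le> m * m" using Suc by simp
  then have "(Suc m)\<^sup>2 \<le> 2 * m\<^sup>2" using Suc(1) unfolding power2_eq_square mult_Suc mult_Suc_right by linarith
  then show ?case using Suc by simp
qed

theorem theorem4p2:
  fixes g k :: nat
    and V :: "'a set"
    and \<G> \<B> :: "'a set set"
  assumes "g \<ge> 4"
    and "int k > \<lceil>real g / 2\<rceil>"
    and "transversal_design (k + 2) g V \<G> \<B>"
  shows "group_equitably_colourable 2 V \<G> \<B>"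
proof -
  interpret TD "k + 2" g V \<G> \<B> using assms by unfold_locales auto
  \<comment> \<open>As \<open>k\<close> is an integer, \<open>k - 1\<close> is at least the ceiling
    of \<open>g / 2\<close>.\<close>
  have le: "g \<le> 2 * (k - 1)" and k: "2 \<le> k - 1" using assms(1,2) by linarith+
  show ?thesis
  proof (cases "g = 6 \<and> k = 4")
    case True
    then show ?thesis by (intro colourable_6_6) auto
  next
    case False
    have "g\<^sup>2 \<le> 2 ^ (k + 1)"
    proof (cases "4 \<le> k - 1")
      case True
      have "g\<^sup>2 \<le> (2 * (k - 1))\<^sup>2" using le by (rule power_mono) simp
      also have "\<dots> = 2 ^ 2 * (k - 1)\<^sup>2" by (simp add: power_mult_distrib)
      also have "\<dots> \<le> 2 ^ 2 * 2 ^ (k - 1)" using square_le_two_power[OF True] by simp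
      also have "\<dots> = 2 ^ (2 + (k - 1))" by (rule power_add[symmetric])
      also have "2 + (k - 1) = k + 1" using k by simp
      finally show ?thesis .
    next
      case small: False
      \<comment> \<open>What remains is 16 against \<open>2 ^ 4\<close>, and 16 or 25 against
        \<open>2 ^ 5\<close>; the excluded pair would need 36 to be at most 32.\<close>
      then have "k = 3 \<and> g = 4 \<or> k = 4 \<and> (g = 4 \<or> g = 5)" using le k assms(1) False by linarith
      then show ?thesis by auto
    qed
    then show ?thesis using assms(1) by (intro colourable_if_square_le) auto
  qed
qed

end
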